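(* Let $(\mathcal{T},I,\otimes)$ be a uniform traced category and let $\mathcal{C}$ be a category. Then $(\mathcal{T}^{\mathcal{C}},I^{\mathcal{C}},\otimes^{\mathcal{C}})$ is a uniform traced category, where $\mathcal{T}^{\mathcal{C}}$ is the category of functors $\mathcal{C}\to\mathcal{T}$ and natural transformations, with the pointwise symmetric monoidal structure $I^{\mathcal{C}}(c):=I$ and $(F\otimes^{\mathcal{C}}G)(c):=F(c)\otimes G(c)$.
   Context: A traced category is a symmetric monoidal category $(\mathcal{T},I,\otimes)$ (associators and unitors suppressed, braiding $\sigma$) with functions $\mathrm{Tr}^U_{A,B}\colon\mathcal{T}(A\otimes U,B\otimes U)\to\mathcal{T}(A,B)$ for all objects $A,B,U$ such that: (naturality) $\mathrm{Tr}^U_{A',B'}((g\otimes U)\circ k\circ(f\otimes U))=g\circ\mathrm{Tr}^U_{A,B}(k)\circ f$ for $f\colon A'\to A$, $g\colon B\to B'$, $k\colon A\otimes U\to B\otimes U$; (dinaturality) $\mathrm{Tr}^V_{A,B}((B\otimes h)\circ k)=\mathrm{Tr}^U_{A,B}(k\circ(A\otimes h))$ for $h\colon U\to V$, $k\colon A\otimes V\to B\otimes U$; (monoidality) $\mathrm{Tr}^I_{A,B}$ is the canonical identification and $\mathrm{Tr}^{U\otimes V}_{A,B}=\mathrm{Tr}^U_{A,B}\circ\mathrm{Tr}^V_{A\otimes U,B\otimes U}$; (superposing) $\mathrm{Tr}^U_{A'\otimes A,B'\otimes B}(h\otimes k)=h\otimes\mathrm{Tr}^U_{A,B}(k)$ for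 $h\colon A'\to B'$; (yanking) $\mathrm{Tr}^U_{U,U}(\sigma_{U,U})=\mathrm{id}_U$. A morphism $s\colon U\to V$ is strict if for all $A,B$, $f\colon A\otimes U\to B\otimes U$, $g\colon A\otimes V\to B\otimes V$ with $(B\otimes s)\circ f=g\circ(A\otimes s)$ one has $\mathrm{Tr}^U_{A,B}(f)=\mathrm{Tr}^V_{A,B}(g)$. A traced category is uniform if every morphism is strict. *)

theory Defs
  imports Main "HOL-Library.FuncSet"
begin

record ('o, 'm) cat_data =
  Obj :: "'o set"
  Arr :: "'m set"
  Dom :: "'m \<Rightarrow> 'o"
  Cod :: "'m \<Rightarrow> 'o"
  Ident :: "'o \<Rightarrow> 'm"  ("\<one>\<index>")
  Comp :: "'m \<Rightarrow> 'm \<Rightarrow> 'm"  (infixl "\<cdot>\<index>" 60)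

definition hom :: "('o, 'm, 'x) cat_data_scheme \<Rightarrow> 'o \<Rightarrow> 'o \<Rightarrow> 'm set"
  where "hom C A B = {f \<in> Arr C. Dom C f = A \<and> Cod C f = B}"

locale category =
  fixes C :: "('o, 'm, 'x) cat_data_scheme" (structure)
  assumes Dom_Obj: "f \<in> Arr C \<Longrightarrow> Dom C f \<in> Obj C"
    and Cod_Obj: "f \<in> Arr C \<Longrightarrow> Cod C f \<in> Obj C"
    and Ident_hom: "X \<in> Obj C \<Longrightarrow> \<one> X \<in> hom C X X"
    and Comp_hom: "\<lbrakk>f \<in> hom C X Y; g \<in> hom C Y Z\<rbrakk> \<Longrightarrow> g \<cdot> f \<in> hom C X Z"
    and Comp_Ident: "f \<in> hom C X Y \<Longrightarrow> f \<cdot> \<one> X = f"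
    and Ident_Comp: "f \<in> hom C X Y \<Longrightarrow> \<one> Y \<cdot> f = f"
    and Comp_assoc: "\<lbrakk>f \<in> hom C W X; g \<in> hom C X Y; h \<in> hom C Y Z\<rbrakk>
          \<Longrightarrow> (h \<cdot> g) \<cdot> f = h \<cdot> (g \<cdot> f)"

definition inverse_pair :: "('o, 'm, 'x) cat_data_scheme \<Rightarrow> 'm \<Rightarrow> 'm \<Rightarrow> bool"
  where "inverse_pair C f g \<longleftrightarrow>
    f \<in> Arr C \<and> g \<in> hom C (Cod C f) (Dom C f) \<and>
    g \<cdot>\<^bsub>C\<^esub> f = \<one>\<^bsub>C\<^esub> (Dom C f) \<and> f \<cdot>\<^bsub>C\<^esub> g = \<one>\<^bsub>C\<^esub> (Cod C f)"

definition iso_arr :: "('o, 'm, 'x) cat_data_scheme \<Rightarrow> 'm \<Rightarrow> bool"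
  where "iso_arr C f \<longleftrightarrow> (\<exists>g. inverse_pair C f g)"

definition inv_arr :: "('o, 'm, 'x) cat_data_scheme \<Rightarrow> 'm \<Rightarrow> 'm"
  where "inv_arr C f = (THE g. inverse_pair C f g)"

record ('o, 'm) smc_data = "('o, 'm) cat_data" +
  UnitObj :: "'o"  ("\<I>\<index>")
  TensorObj :: "'o \<Rightarrow> 'o \<Rightarrow> 'o"  (infixl "\<odot>\<index>" 70)
  TensorArr :: "'m \<Rightarrow> 'm \<Rightarrow> 'm"  (infixl "\<otimes>\<index>" 70)
  Assoc :: "'o \<Rightarrow> 'o \<Rightarrow> 'o \<Rightarrow> 'm"  ("\<alpha>\<index>")
  LUnit :: "'o \<Rightarrow> 'm"  ("\<ell>\<index>")
  RUnit :: "'o \<Rightarrow> 'm"  ("\<rho>\<index>")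
  Braid :: "'o \<Rightarrow> 'o \<Rightarrow> 'm"  ("\<sigma>\<index>")

text \<open>
  The tensor of objects is written \<open>\<odot>\<close>, that of arrows \<open>\<otimes>\<close>.
  Associators and unitors are explicit, so that no strictness is assumed.  The
  associator goes from \<open>(X \<odot> Y) \<odot> Z\<close> to \<open>X \<odot> (Y \<odot> Z)\<close>.
\<close>

locale symmetric_monoidal_category = category T
  for T :: "('o, 'm, 'x) smc_data_scheme" (structure) +
  assumes UnitObj_Obj: "\<I> \<in> Obj T"
    and TensorObj_Obj: "\<lbrakk>X \<in> Obj T; Y \<in> Obj T\<rbrakk> \<Longrightarrow> X \<odot> Y \<in> Obj T"
    and TensorArr_hom: "\<lbrakk>f \<in> hom T X X'; g \<in> hom T Y Y'\<rbrakk>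
          \<Longrightarrow> f \<otimes> g \<in> hom T (X \<odot> Y) (X' \<odot> Y')"
    and TensorArr_Ident: "\<lbrakk>X \<in> Obj T; Y \<in> Obj T\<rbrakk> \<Longrightarrow> \<one> X \<otimes> \<one> Y = \<one> (X \<odot> Y)"
    and TensorArr_Comp:
      "\<lbrakk>f \<in> hom T X X'; f' \<in> hom T X' X''; g \<in> hom T Y Y'; g' \<in> hom T Y' Y''\<rbrakk>
          \<Longrightarrow> (f' \<cdot> f) \<otimes> (g' \<cdot> g) = (f' \<otimes> g') \<cdot> (f \<otimes> g)"
    and Assoc_hom: "\<lbrakk>X \<in> Obj T; Y \<in> Obj T; Z \<in> Obj T\<rbrakk>
          \<Longrightarrow> \<alpha> X Y Z \<in> hom T ((X \<odot> Y) \<odot> Z) (X \<odot> (Y \<odot> Z))"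
    and Assoc_iso: "\<lbrakk>X \<in> Obj T; Y \<in> Obj T; Z \<in> Obj T\<rbrakk> \<Longrightarrow> iso_arr T (\<alpha> X Y Z)"
    and Assoc_natural: "\<lbrakk>f \<in> hom T X X'; g \<in> hom T Y Y'; h \<in> hom T Z Z'\<rbrakk>
          \<Longrightarrow> \<alpha> X' Y' Z' \<cdot> ((f \<otimes> g) \<otimes> h) = (f \<otimes> (g \<otimes> h)) \<cdot> \<alpha> X Y Z"
    and LUnit_hom: "X \<in> Obj T \<Longrightarrow> \<ell> X \<in> hom T (\<I> \<odot> X) X"
    and LUnit_iso: "X \<in> Obj T \<Longrightarrow> iso_arr T (\<ell> X)"
    and LUnit_natural: "f \<in> hom T X Y \<Longrightarrow> \<ell> Y \<cdot> (\<one> \<I> \<otimes> f) = f \<cdot> \<ell> X"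
    and RUnit_hom: "X \<in> Obj T \<Longrightarrow> \<rho> X \<in> hom T (X \<odot> \<I>) X"
    and RUnit_iso: "X \<in> Obj T \<Longrightarrow> iso_arr T (\<rho> X)"
    and RUnit_natural: "f \<in> hom T X Y \<Longrightarrow> \<rho> Y \<cdot> (f \<otimes> \<one> \<I>) = f \<cdot> \<rho> X"
    and Braid_hom: "\<lbrakk>X \<in> Obj T; Y \<in> Obj T\<rbrakk> \<Longrightarrow> \<sigma> X Y \<in> hom T (X \<odot> Y) (Y \<odot> X)"
    and Braid_natural: "\<lbrakk>f \<in> hom T X X'; g \<in> hom T Y Y'\<rbrakk>
          \<Longrightarrow> \<sigma> X' Y' \<cdot> (f \<otimes> g) = (g \<otimes> f) \<cdot> \<sigma> X Y"
    and Braid_symmetric: "\<lbrakk>X \<in> Obj T; Y \<in> Obj T\<rbrakk> \<Longrightarrow> \<sigma> Y X \<cdot> \<sigma> X Y = \<one> (X \<odot> Y)"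
    and pentagon: "\<lbrakk>W \<in> Obj T; X \<in> Obj T; Y \<in> Obj T; Z \<in> Obj T\<rbrakk>
          \<Longrightarrow> \<alpha> W X (Y \<odot> Z) \<cdot> \<alpha> (W \<odot> X) Y Z
            = (\<one> W \<otimes> \<alpha> X Y Z) \<cdot> \<alpha> W (X \<odot> Y) Z \<cdot> (\<alpha> W X Y \<otimes> \<one> Z)"
    and triangle: "\<lbrakk>X \<in> Obj T; Y \<in> Obj T\<rbrakk>
          \<Longrightarrow> (\<one> X \<otimes> \<ell> Y) \<cdot> \<alpha> X \<I> Y = \<rho> X \<otimes> \<one> Y"
    and hexagon: "\<lbrakk>X \<in> Obj T; Y \<in> Obj T; Z \<in> Obj T\<rbrakk>
          \<Longrightarrow> \<alpha> Y Z X \<cdot> \<sigma> X (Y \<odot> Z) \<cdot> \<alpha> X Y Z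
            = (\<one> Y \<otimes> \<sigma> X Z) \<cdot> \<alpha> Y X Z \<cdot> (\<sigma> X Y \<otimes> \<one> Z)"

text \<open>\<open>Tr U A B\<close> is the trace operator usually written with superscript \<open>U\<close> and
  subscripts \<open>A, B\<close>.\<close>

record ('o, 'm) traced_data = "('o, 'm) smc_data" +
  Trace :: "'o \<Rightarrow> 'o \<Rightarrow> 'o \<Rightarrow> 'm \<Rightarrow> 'm"  ("Tr\<index>")

locale traced_category = symmetric_monoidal_category T
  for T :: "('o, 'm, 'x) traced_data_scheme" (structure) +
  assumes Trace_hom:
      "\<lbrakk>A \<in> Obj T; B \<in> Obj T; U \<in> Obj T; k \<in> hom T (A \<odot> U) (B \<odot> U)\<rbrakk>
        \<Longrightarrow> Tr U A B k \<in> hom T A B"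
    and naturality:
      "\<lbrakk>U \<in> Obj T; f \<in> hom T A' A; g \<in> hom T B B'; k \<in> hom T (A \<odot> U) (B \<odot> U)\<rbrakk>
        \<Longrightarrow> Tr U A' B' ((g \<otimes> \<one> U) \<cdot> k \<cdot> (f \<otimes> \<one> U)) = g \<cdot> Tr U A B k \<cdot> f"
    and dinaturality:
      "\<lbrakk>A \<in> Obj T; B \<in> Obj T; h \<in> hom T U V; k \<in> hom T (A \<odot> V) (B \<odot> U)\<rbrakk>
        \<Longrightarrow> Tr V A B ((\<one> B \<otimes> h) \<cdot> k) = Tr U A B (k \<cdot> (\<one> A \<otimes> h))"
    and monoidality_unit:
      "\<lbrakk>A \<in> Obj T; B \<in> Obj T; k \<in> hom T (A \<odot> \<I>) (B \<odot> \<I>)\<rbrakk>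
        \<Longrightarrow> Tr \<I> A B k = \<rho> B \<cdot> k \<cdot> inv_arr T (\<rho> A)"
    and monoidality_tensor:
      "\<lbrakk>A \<in> Obj T; B \<in> Obj T; U \<in> Obj T; V \<in> Obj T;
        k \<in> hom T (A \<odot> (U \<odot> V)) (B \<odot> (U \<odot> V))\<rbrakk>
        \<Longrightarrow> Tr (U \<odot> V) A B k
          = Tr U A B (Tr V (A \<odot> U) (B \<odot> U) (inv_arr T (\<alpha> B U V) \<cdot> k \<cdot> \<alpha> A U V))"
    and superposing:
      "\<lbrakk>A \<in> Obj T; B \<in> Obj T; U \<in> Obj T; h \<in> hom T A' B'; k \<in> hom T (A \<odot> U) (B \<odot> U)\<rbrakk>
        \<Longrightarrow> Tr U (A' \<odot> A) (B' \<odot> B) (inv_arr T (\<alpha> B' B U) \<cdot> (h \<otimes> k) \<cdot> \<alpha> A' A U)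
          = h \<otimes> Tr U A B k"
    and yanking: "U \<in> Obj T \<Longrightarrow> Tr U U U (\<sigma> U U) = \<one> U"

definition strict_arr :: "('o, 'm, 'x) traced_data_scheme \<Rightarrow> 'm \<Rightarrow> bool"
  where "strict_arr T s \<longleftrightarrow>
    s \<in> Arr T \<and>
    (let U = Dom T s; V = Cod T s in
      \<forall>A\<in>Obj T. \<forall>B\<in>Obj T.
      \<forall>f\<in>hom T (A \<odot>\<^bsub>T\<^esub> U) (B \<odot>\<^bsub>T\<^esub> U). \<forall>g\<in>hom T (A \<odot>\<^bsub>T\<^esub> V) (B \<odot>\<^bsub>T\<^esub> V).
        (\<one>\<^bsub>T\<^esub> B \<otimes>\<^bsub>T\<^esub> s) \<cdot>\<^bsub>T\<^esub> f = g \<cdot>\<^bsub>T\<^esub> (\<one>\<^bsub>T\<^esub> A \<otimes>\<^bsub>T\<^esub> s)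
        \<longrightarrow> Tr\<^bsub>T\<^esub> U A B f = Tr\<^bsub>T\<^esub> V A B g)"

locale uniform_traced_category = traced_category T
  for T :: "('o, 'm, 'x) traced_data_scheme" (structure) +
  assumes uniform: "s \<in> Arr T \<Longrightarrow> strict_arr T s"

text \<open>
  Functors and natural transformations are required to be extensional (\<open>undefined\<close>
  outside their domain), so that equality in HOL is equality of functors and of
  natural transformations.  A natural transformation carries its source and target.
\<close>

record ('c, 'd, 'o, 'm) func =
  FObj :: "'c \<Rightarrow> 'o"
  FArr :: "'d \<Rightarrow> 'm"

definition functors ::
    "('c, 'd, 'x) cat_data_scheme \<Rightarrow> ('o, 'm, 'y) cat_data_scheme \<Rightarrow> ('c, 'd, 'o, 'm) func set"
  where "functors C D = {F.
    FObj F \<in> extensional (Obj C) \<and> FArr F \<in> extensional (Arr C) \<and>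
    (\<forall>c\<in>Obj C. FObj F c \<in> Obj D) \<and>
    (\<forall>\<phi>\<in>Arr C. FArr F \<phi> \<in> hom D (FObj F (Dom C \<phi>)) (FObj F (Cod C \<phi>))) \<and>
    (\<forall>c\<in>Obj C. FArr F (\<one>\<^bsub>C\<^esub> c) = \<one>\<^bsub>D\<^esub> (FObj F c)) \<and>
    (\<forall>\<phi>\<in>Arr C. \<forall>\<psi>\<in>Arr C. Cod C \<phi> = Dom C \<psi> \<longrightarrow>
      FArr F (\<psi> \<cdot>\<^bsub>C\<^esub> \<phi>) = FArr F \<psi> \<cdot>\<^bsub>D\<^esub> FArr F \<phi>)}"

record ('c, 'd, 'o, 'm) nat_trans =
  Src :: "('c, 'd, 'o, 'm) func"
  Trg :: "('c, 'd, 'o, 'm) func"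
  Cmp :: "'c \<Rightarrow> 'm"

definition nat_transformations ::
    "('c, 'd, 'x) cat_data_scheme \<Rightarrow> ('o, 'm, 'y) cat_data_scheme
      \<Rightarrow> ('c, 'd, 'o, 'm) nat_trans set"
  where "nat_transformations C D = {\<tau>.
    Src \<tau> \<in> functors C D \<and> Trg \<tau> \<in> functors C D \<and> Cmp \<tau> \<in> extensional (Obj C) \<and>
    (\<forall>c\<in>Obj C. Cmp \<tau> c \<in> hom D (FObj (Src \<tau>) c) (FObj (Trg \<tau>) c)) \<and>
    (\<forall>\<phi>\<in>Arr C. Cmp \<tau> (Cod C \<phi>) \<cdot>\<^bsub>D\<^esub> FArr (Src \<tau>) \<phi>
      = FArr (Trg \<tau>) \<phi> \<cdot>\<^bsub>D\<^esub> Cmp \<tau> (Dom C \<phi>))}"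

definition unit_functor ::
    "('c, 'd, 'x) cat_data_scheme \<Rightarrow> ('o, 'm, 'y) smc_data_scheme \<Rightarrow> ('c, 'd, 'o, 'm) func"
  where "unit_functor C T =
    \<lparr>FObj = (\<lambda>c\<in>Obj C. \<I>\<^bsub>T\<^esub>), FArr = (\<lambda>\<phi>\<in>Arr C. \<one>\<^bsub>T\<^esub> \<I>\<^bsub>T\<^esub>)\<rparr>"

definition tensor_functor ::
    "('c, 'd, 'x) cat_data_scheme \<Rightarrow> ('o, 'm, 'y) smc_data_scheme
      \<Rightarrow> ('c, 'd, 'o, 'm) func \<Rightarrow> ('c, 'd, 'o, 'm) func \<Rightarrow> ('c, 'd, 'o, 'm) func"
  where "tensor_functor C T F G =
    \<lparr>FObj = (\<lambda>c\<in>Obj C. FObj F c \<odot>\<^bsub>T\<^esub> FObj G c),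
     FArr = (\<lambda>\<phi>\<in>Arr C. FArr F \<phi> \<otimes>\<^bsub>T\<^esub> FArr G \<phi>)\<rparr>"

text \<open>
  All structure, including the trace, is componentwise in \<open>T\<close>.  The componentwise
  trace of a natural transformation need not be natural for an arbitrary traced \<open>T\<close>.
\<close>

definition functor_category ::
    "('c, 'd, 'x) cat_data_scheme \<Rightarrow> ('o, 'm, 'y) traced_data_scheme
      \<Rightarrow> (('c, 'd, 'o, 'm) func, ('c, 'd, 'o, 'm) nat_trans) traced_data"
  where "functor_category C T = (let ten = tensor_functor C T; un = unit_functor C T in
    \<lparr>Obj = functors C T,
     Arr = nat_transformations C T,
     Dom = Src,
     Cod = Trg,
     Ident = (\<lambda>F. \<lparr>Src = F, Trg = F, Cmp = (\<lambda>c\<in>Obj C. \<one>\<^bsub>T\<^esub> (FObj F c))\<rparr>),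
     Comp = (\<lambda>\<tau> \<upsilon>. \<lparr>Src = Src \<upsilon>, Trg = Trg \<tau>,
       Cmp = (\<lambda>c\<in>Obj C. Cmp \<tau> c \<cdot>\<^bsub>T\<^esub> Cmp \<upsilon> c)\<rparr>),
     UnitObj = un,
     TensorObj = ten,
     TensorArr = (\<lambda>\<tau> \<upsilon>. \<lparr>Src = ten (Src \<tau>) (Src \<upsilon>), Trg = ten (Trg \<tau>) (Trg \<upsilon>),
       Cmp = (\<lambda>c\<in>Obj C. Cmp \<tau> c \<otimes>\<^bsub>T\<^esub> Cmp \<upsilon> c)\<rparr>),
     Assoc = (\<lambda>F G H. \<lparr>Src = ten (ten F G) H, Trg = ten F (ten G H),
       Cmp = (\<lambda>c\<in>Obj C. \<alpha>\<^bsub>T\<^esub> (FObj F c) (FObj G c) (FObj H c))\<rparr>),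
     LUnit = (\<lambda>F. \<lparr>Src = ten un F, Trg = F, Cmp = (\<lambda>c\<in>Obj C. \<ell>\<^bsub>T\<^esub> (FObj F c))\<rparr>),
     RUnit = (\<lambda>F. \<lparr>Src = ten F un, Trg = F, Cmp = (\<lambda>c\<in>Obj C. \<rho>\<^bsub>T\<^esub> (FObj F c))\<rparr>),
     Braid = (\<lambda>F G. \<lparr>Src = ten F G, Trg = ten G F,
       Cmp = (\<lambda>c\<in>Obj C. \<sigma>\<^bsub>T\<^esub> (FObj F c) (FObj G c))\<rparr>),
     Trace = (\<lambda>P F G \<tau>. \<lparr>Src = F, Trg = G,
       Cmp = (\<lambda>c\<in>Obj C. Tr\<^bsub>T\<^esub> (FObj P c) (FObj F c) (FObj G c) (Cmp \<tau> c))\<rparr>)\<rparr>)"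

end

theory Submission
  imports Defs
begin

text \<open>
  All equational axioms of a traced category are inherited pointwise: an equation between
  natural transformations is the family of the corresponding equations in \<open>T\<close>, one for each
  object of \<open>C\<close>.  This also applies to the axioms that mention inverses of structural arrows,
  because the inverse of a pointwise invertible natural transformation is again natural
  (\<open>pointwise_inverse\<close>).  Uniformity is inherited pointwise as well.

  The only point that needs an argument is that the pointwise trace of a natural
  transformation \<open>k : F \<otimes> P \<rightarrow> G \<otimes> P\<close> is natural, and this is where uniformity of \<open>T\<close> enters.
  For \<open>\<phi> : c \<rightarrow> d\<close>, naturality of the trace in \<open>T\<close> turns the two sides of the required square into
  the traces of \<open>(G \<phi> \<otimes> 1) \<cdot> k c\<close>, taken over \<open>P c\<close>, and of \<open>k d \<cdot> (F \<phi> \<otimes> 1)\<close>, taken over \<open>P d\<close>.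
  Naturality of \<open>k\<close> says exactly that \<open>P \<phi>\<close> intertwines these two arrows, and \<open>P \<phi>\<close> is strict
  (\<open>trace_commutes_with_squares\<close>).
\<close>

section \<open>Categories: inverses and pasting of squares\<close>

context category
begin

lemma hom_Dom_Obj: "f \<in> hom C X Y \<Longrightarrow> X \<in> Obj C"
  using Dom_Obj by (auto simp: hom_def)

lemma hom_Cod_Obj: "f \<in> hom C X Y \<Longrightarrow> Y \<in> Obj C"
  using Cod_Obj by (auto simp: hom_def)

lemma inverse_pair_unique:
  assumes "inverse_pair C f g" and "inverse_pair C f h"
  shows "g = h"
proof -
  have f: "f \<in> hom C (Dom C f) (Cod C f)"
    and g: "g \<in> hom C (Cod C f) (Dom C f)"
    and h: "h \<in> hom C (Cod C f) (Dom C f)"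
    using assms by (auto simp: inverse_pair_def hom_def)
  have "g = g \<cdot> (f \<cdot> h)"
    using assms Comp_Ident[OF g] by (simp add: inverse_pair_def)
  also have "\<dots> = (g \<cdot> f) \<cdot> h"
    using Comp_assoc[OF h f g] by simp
  also have "\<dots> = h"
    using assms Ident_Comp[OF h] by (simp add: inverse_pair_def)
  finally show ?thesis .
qed

lemma inv_arr_eqI: "inverse_pair C f g \<Longrightarrow> inv_arr C f = g"
  unfolding inv_arr_def using inverse_pair_unique by blast

lemma inverse_pair_inv_arr: "iso_arr C f \<Longrightarrow> inverse_pair C f (inv_arr C f)"
  using inv_arr_eqI by (auto simp: iso_arr_def)

lemma
  assumes "f \<in> hom C X Y" and "iso_arr C f"
  shows inv_arr_hom: "inv_arr C f \<in> hom C Y X"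
    and inv_arr_Comp: "inv_arr C f \<cdot> f = \<one> X"
    and Comp_inv_arr: "f \<cdot> inv_arr C f = \<one> Y"
  using inverse_pair_inv_arr[OF assms(2)] assms(1)
  by (auto simp: inverse_pair_def hom_def)

lemma paste_squares:
  assumes "f \<in> hom C X Y" "g \<in> hom C Y Z" "f' \<in> hom C X' Y'" "g' \<in> hom C Y' Z'"
    and "a \<in> hom C X X'" "b \<in> hom C Y Y'" "c \<in> hom C Z Z'"
    and top: "b \<cdot> f = f' \<cdot> a" and bottom: "c \<cdot> g = g' \<cdot> b"
  shows "c \<cdot> (g \<cdot> f) = (g' \<cdot> f') \<cdot> a"
proof -
  have "c \<cdot> (g \<cdot> f) = (c \<cdot> g) \<cdot> f"
    using Comp_assoc[OF assms(1,2,7)] by simp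
  also have "\<dots> = g' \<cdot> (b \<cdot> f)"
    using bottom Comp_assoc[OF assms(1,6,4)] by simp
  also have "\<dots> = (g' \<cdot> f') \<cdot> a"
    using top Comp_assoc[OF assms(5,3,4)] by simp
  finally show ?thesis .
qed

lemma square_of_inverses:
  assumes f: "f \<in> hom C X Y" "iso_arr C f" and g: "g \<in> hom C X' Y'" "iso_arr C g"
    and a: "a \<in> hom C X X'" and b: "b \<in> hom C Y Y'" and square: "g \<cdot> a = b \<cdot> f"
  shows "inv_arr C g \<cdot> b = a \<cdot> inv_arr C f"
proof -
  note f' = inv_arr_hom[OF f] and g' = inv_arr_hom[OF g]
  have "inv_arr C g \<cdot> b = inv_arr C g \<cdot> (b \<cdot> (f \<cdot> inv_arr C f))"
    using Comp_Ident[OF b] Comp_inv_arr[OF f] by simp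
  also have "\<dots> = inv_arr C g \<cdot> ((g \<cdot> a) \<cdot> inv_arr C f)"
    using Comp_assoc[OF f' f(1) b] square by simp
  also have "\<dots> = (inv_arr C g \<cdot> g) \<cdot> (a \<cdot> inv_arr C f)"
    using Comp_assoc[OF f' a g(1)] Comp_assoc[OF Comp_hom[OF f' a] g(1) g'] by simp
  also have "\<dots> = a \<cdot> inv_arr C f"
    using inv_arr_Comp[OF g] Ident_Comp[OF Comp_hom[OF f' a]] by simp
  finally show ?thesis .
qed

end

section \<open>Traces of commuting squares\<close>

text \<open>
  Uniformity lets the feedback object vary along \<open>u\<close>, and naturality of the trace lets the
  input and output objects vary along \<open>a\<close> and \<open>b\<close>; together they say that the trace is
  functorial on commuting squares.
\<close>

lemma (in uniform_traced_category) trace_commutes_with_squares: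
  assumes k: "k \<in> hom T (A \<odot> U) (B \<odot> U)" and k': "k' \<in> hom T (A' \<odot> U') (B' \<odot> U')"
    and a: "a \<in> hom T A A'" and b: "b \<in> hom T B B'" and u: "u \<in> hom T U U'"
    and square: "k' \<cdot> (a \<otimes> u) = (b \<otimes> u) \<cdot> k"
  shows "Tr U' A' B' k' \<cdot> a = b \<cdot> Tr U A B k"
proof -
  note objs = hom_Dom_Obj[OF a] hom_Cod_Obj[OF a] hom_Dom_Obj[OF b] hom_Cod_Obj[OF b]
    hom_Dom_Obj[OF u] hom_Cod_Obj[OF u]
  have ids: "\<one> A \<in> hom T A A" "\<one> B' \<in> hom T B' B'" "\<one> B \<in> hom T B B" "\<one> A' \<in> hom T A' A'"
    "\<one> U \<in> hom T U U" "\<one> U' \<in> hom T U' U'"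
    using objs Ident_hom by auto
  note bU = TensorArr_hom[OF b ids(5)] and aU = TensorArr_hom[OF a ids(6)]
    and uA = TensorArr_hom[OF ids(1) u] and uB = TensorArr_hom[OF ids(2) u]
  let ?f = "(b \<otimes> \<one> U) \<cdot> k" and ?g = "k' \<cdot> (a \<otimes> \<one> U')"
  have f: "?f \<in> hom T (A \<odot> U) (B' \<odot> U)" and g: "?g \<in> hom T (A \<odot> U') (B' \<odot> U')"
    using Comp_hom k k' bU aU by auto
  \<comment> \<open>Interchange splits the two tensored sides of the square as
    \<open>b \<otimes> u = (1 \<otimes> u) \<cdot> (b \<otimes> 1)\<close> and \<open>a \<otimes> u = (a \<otimes> 1) \<cdot> (1 \<otimes> u)\<close>.\<close>
  have "(\<one> B' \<otimes> u) \<cdot> ?f = ((\<one> B' \<cdot> b) \<otimes> (u \<cdot> \<one> U)) \<cdot> k"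
    using Comp_assoc[OF k bU uB] TensorArr_Comp[OF b ids(2) ids(5) u] by simp
  also have "\<dots> = k' \<cdot> (a \<otimes> u)"
    using Ident_Comp[OF b] Comp_Ident[OF u] square by simp
  also have "\<dots> = k' \<cdot> ((a \<cdot> \<one> A) \<otimes> (\<one> U' \<cdot> u))"
    using Comp_Ident[OF a] Ident_Comp[OF u] by simp
  also have "\<dots> = ?g \<cdot> (\<one> A \<otimes> u)"
    using Comp_assoc[OF uA aU k'] TensorArr_Comp[OF ids(1) a u ids(6)] by simp
  finally have intertwine: "(\<one> B' \<otimes> u) \<cdot> ?f = ?g \<cdot> (\<one> A \<otimes> u)" .
  have "strict_arr T u" "Dom T u = U" "Cod T u = U'"
    using uniform u by (auto simp: hom_def)
  then have "Tr U A B' ?f = Tr U' A B' ?g"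
    using f g intertwine objs by (auto simp: strict_arr_def Let_def)
  moreover have "Tr U A B' ?f = b \<cdot> Tr U A B k"
    using naturality[OF objs(5) ids(1) b k] TensorArr_Ident[OF objs(1) objs(5)]
      Comp_Ident[OF f] Comp_Ident[OF Comp_hom[OF Trace_hom[OF objs(1,3,5) k] b]] by simp
  moreover have "Tr U' A B' ?g = Tr U' A' B' k' \<cdot> a"
    using naturality[OF objs(6) a ids(2) k'] TensorArr_Ident[OF objs(4) objs(6)]
      Ident_Comp[OF k'] Ident_Comp[OF Trace_hom[OF objs(2,4,6) k']] by simp
  ultimately show ?thesis by simp
qed

section \<open>Functors and natural transformations\<close>

locale functors_into_smc = C: category C + T: symmetric_monoidal_category T
  for C :: "('c, 'd, 'x) cat_data_scheme"
    and T :: "('o, 'm, 'y) traced_data_scheme" (structure)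
begin

abbreviation FC where "FC \<equiv> functor_category C T"

text \<open>Every structural arrow of the functor category has this form, which reduces the typing
  and the equality of arrows to two rules.\<close>

definition transformation where
  "transformation F G t = \<lparr>Src = F, Trg = G, Cmp = (\<lambda>c\<in>Obj C. t c)\<rparr>"

lemma FC_simps:
  "Obj FC = functors C T"
  "Dom FC = Src" "Cod FC = Trg" "Arr FC = nat_transformations C T"
  "UnitObj FC = unit_functor C T"
  "TensorObj FC = tensor_functor C T"
  "Ident FC F = transformation F F (\<lambda>c. \<one> (FObj F c))"
  "Comp FC q p = transformation (Src p) (Trg q) (\<lambda>c. Cmp q c \<cdot> Cmp p c)"
  "TensorArr FC p q = transformation (tensor_functor C T (Src p) (Src q))
     (tensor_functor C T (Trg p) (Trg q)) (\<lambda>c. Cmp p c \<otimes> Cmp q c)"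
  "Assoc FC F G H = transformation (tensor_functor C T (tensor_functor C T F G) H)
     (tensor_functor C T F (tensor_functor C T G H)) (\<lambda>c. \<alpha> (FObj F c) (FObj G c) (FObj H c))"
  "LUnit FC F = transformation (tensor_functor C T (unit_functor C T) F) F (\<lambda>c. \<ell> (FObj F c))"
  "RUnit FC F = transformation (tensor_functor C T F (unit_functor C T)) F (\<lambda>c. \<rho> (FObj F c))"
  "Braid FC F G = transformation (tensor_functor C T F G) (tensor_functor C T G F)
     (\<lambda>c. \<sigma> (FObj F c) (FObj G c))"
  "Trace FC P F G k = transformation F G (\<lambda>c. Tr (FObj P c) (FObj F c) (FObj G c) (Cmp k c))"
  by (simp_all add: functor_category_def Let_def transformation_def)

lemma transformation_simps [simp]:
  "Src (transformation F G t) = F" "Trg (transformation F G t) = G"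
  "c \<in> Obj C \<Longrightarrow> Cmp (transformation F G t) c = t c"
  by (simp_all add: transformation_def)

lemma FObj_simps [simp]:
  "c \<in> Obj C \<Longrightarrow> FObj (unit_functor C T) c = \<I>"
  "c \<in> Obj C \<Longrightarrow> FObj (tensor_functor C T F G) c = FObj F c \<odot> FObj G c"
  by (simp_all add: unit_functor_def tensor_functor_def)

lemma FArr_simps [simp]:
  "p \<in> hom C c d \<Longrightarrow> FArr (unit_functor C T) p = \<one> \<I>"
  "p \<in> hom C c d \<Longrightarrow> FArr (tensor_functor C T F G) p = FArr F p \<otimes> FArr G p"
  by (simp_all add: unit_functor_def tensor_functor_def hom_def)

lemma FObj_Obj: "\<lbrakk>F \<in> functors C T; c \<in> Obj C\<rbrakk> \<Longrightarrow> FObj F c \<in> Obj T"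
  by (simp add: functors_def)

lemma FArr_hom: "\<lbrakk>F \<in> functors C T; p \<in> hom C c d\<rbrakk> \<Longrightarrow> FArr F p \<in> hom T (FObj F c) (FObj F d)"
  by (auto simp: functors_def hom_def)

lemma FArr_Ident: "\<lbrakk>F \<in> functors C T; c \<in> Obj C\<rbrakk> \<Longrightarrow> FArr F (\<one>\<^bsub>C\<^esub> c) = \<one> (FObj F c)"
  by (simp add: functors_def)

lemma FArr_Comp:
  "\<lbrakk>F \<in> functors C T; p \<in> hom C c d; q \<in> hom C d e\<rbrakk>
    \<Longrightarrow> FArr F (q \<cdot>\<^bsub>C\<^esub> p) = FArr F q \<cdot> FArr F p"
  by (simp add: functors_def hom_def)

lemma functorsI:
  assumes "FObj F \<in> extensional (Obj C)" "FArr F \<in> extensional (Arr C)"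
    and "\<And>c. c \<in> Obj C \<Longrightarrow> FObj F c \<in> Obj T"
    and "\<And>p c d. p \<in> hom C c d \<Longrightarrow> FArr F p \<in> hom T (FObj F c) (FObj F d)"
    and "\<And>c. c \<in> Obj C \<Longrightarrow> FArr F (\<one>\<^bsub>C\<^esub> c) = \<one> (FObj F c)"
    and "\<And>p q c d e. \<lbrakk>p \<in> hom C c d; q \<in> hom C d e\<rbrakk>
      \<Longrightarrow> FArr F (q \<cdot>\<^bsub>C\<^esub> p) = FArr F q \<cdot> FArr F p"
  shows "F \<in> functors C T"
  using assms unfolding functors_def hom_def by simp

lemma Cmp_hom: "\<lbrakk>t \<in> hom FC F G; c \<in> Obj C\<rbrakk> \<Longrightarrow> Cmp t c \<in> hom T (FObj F c) (FObj G c)"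
  by (auto simp: hom_def FC_simps nat_transformations_def)

lemma Cmp_natural:
  "\<lbrakk>t \<in> hom FC F G; p \<in> hom C c d\<rbrakk> \<Longrightarrow> Cmp t d \<cdot> FArr F p = FArr G p \<cdot> Cmp t c"
  by (auto simp: hom_def FC_simps nat_transformations_def)

lemma FC_homD:
  assumes "t \<in> hom FC F G"
  shows "F \<in> functors C T" "G \<in> functors C T" "Src t = F" "Trg t = G"
  using assms by (auto simp: hom_def FC_simps nat_transformations_def)

lemma transformation_hom:
  assumes "F \<in> functors C T" "G \<in> functors C T"
    and "\<And>c. c \<in> Obj C \<Longrightarrow> t c \<in> hom T (FObj F c) (FObj G c)"
    and "\<And>p c d. \<lbrakk>p \<in> hom C c d; c \<in> Obj C; d \<in> Obj C\<rbrakk> \<Longrightarrow> t d \<cdot> FArr F p = FArr G p \<cdot> t c"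
  shows "transformation F G t \<in> hom FC F G"
  using assms C.Dom_Obj C.Cod_Obj
  by (auto simp: transformation_def hom_def[of FC] hom_def[of C] FC_simps nat_transformations_def)

lemma FC_arr_eqI:
  assumes "t \<in> hom FC F G" "u \<in> hom FC F G"
    and "\<And>c. c \<in> Obj C \<Longrightarrow> Cmp t c = Cmp u c"
  shows "t = u"
proof -
  have "Cmp t = Cmp u"
    using assms
    by (intro extensionalityI[where A = "Obj C"])
      (auto simp: hom_def FC_simps nat_transformations_def)
  then show ?thesis
    using assms by (auto simp: hom_def FC_simps)
qed

section \<open>The category of functors\<close>

lemma FC_Ident_hom: "F \<in> functors C T \<Longrightarrow> Ident FC F \<in> hom FC F F"
  unfolding FC_simps
  by (rule transformation_hom)
    (auto simp: T.Ident_hom FObj_Obj T.Ident_Comp[OF FArr_hom] T.Comp_Ident[OF FArr_hom])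

lemma FC_Comp_hom:
  assumes t: "t \<in> hom FC F G" and u: "u \<in> hom FC G H"
  shows "Comp FC u t \<in> hom FC F H"
proof -
  note F = FC_homD[OF t] and G = FC_homD[OF u]
  show ?thesis
    unfolding FC_simps F G
  proof (rule transformation_hom)
    fix c assume "c \<in> Obj C"
    then show "Cmp u c \<cdot> Cmp t c \<in> hom T (FObj F c) (FObj H c)"
      using Cmp_hom t u T.Comp_hom by blast
  next
    fix p c d assume p: "p \<in> hom C c d" and cd: "c \<in> Obj C" "d \<in> Obj C"
    have "FArr H p \<cdot> (Cmp u c \<cdot> Cmp t c) = (Cmp u d \<cdot> Cmp t d) \<cdot> FArr F p"
      by (rule T.paste_squares[OF Cmp_hom[OF t cd(1)] Cmp_hom[OF u cd(1)]
            Cmp_hom[OF t cd(2)] Cmp_hom[OF u cd(2)]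
            FArr_hom[OF F(1) p] FArr_hom[OF F(2) p] FArr_hom[OF G(2) p]])
        (use Cmp_natural t u p in auto)
    then show "(Cmp u d \<cdot> Cmp t d) \<cdot> FArr F p = FArr H p \<cdot> (Cmp u c \<cdot> Cmp t c)" by simp
  qed (use F G in auto)
qed

lemma Cmp_Ident [simp]: "c \<in> Obj C \<Longrightarrow> Cmp (Ident FC F) c = \<one> (FObj F c)"
  by (simp add: FC_simps)

lemma Cmp_Comp [simp]: "c \<in> Obj C \<Longrightarrow> Cmp (Comp FC u t) c = Cmp u c \<cdot> Cmp t c"
  by (simp add: FC_simps)

lemma FC_category: "category FC"
proof
  fix f assume "f \<in> Arr FC"
  then show "Dom FC f \<in> Obj FC" "Cod FC f \<in> Obj FC"
    by (simp_all add: FC_simps nat_transformations_def)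
next
  fix X assume "X \<in> Obj FC"
  then show "Ident FC X \<in> hom FC X X"
    by (intro FC_Ident_hom) (simp add: FC_simps)
next
  fix f g X Y Z assume "f \<in> hom FC X Y" "g \<in> hom FC Y Z"
  then show "Comp FC g f \<in> hom FC X Z" by (rule FC_Comp_hom)
next
  fix f X Y assume f: "f \<in> hom FC X Y"
  show "Comp FC f (Ident FC X) = f"
    by (rule FC_arr_eqI[OF FC_Comp_hom[OF FC_Ident_hom f] f])
      (auto simp: FC_homD[OF f] T.Comp_Ident[OF Cmp_hom[OF f]])
  show "Comp FC (Ident FC Y) f = f"
    by (rule FC_arr_eqI[OF FC_Comp_hom[OF f FC_Ident_hom] f])
      (auto simp: FC_homD[OF f] T.Ident_Comp[OF Cmp_hom[OF f]])
next
  fix f g h W X Y Z assume f: "f \<in> hom FC W X" and g: "g \<in> hom FC X Y" and h: "h \<in> hom FC Y Z"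
  show "Comp FC (Comp FC h g) f = Comp FC h (Comp FC g f)"
    by (rule FC_arr_eqI[OF FC_Comp_hom[OF f FC_Comp_hom[OF g h]]
          FC_Comp_hom[OF FC_Comp_hom[OF f g] h]])
      (simp add: T.Comp_assoc[OF Cmp_hom[OF f] Cmp_hom[OF g] Cmp_hom[OF h]])
qed

sublocale FC: category FC
  by (rule FC_category)

text \<open>Naturality squares remain commuting when both parallel sides are inverted.\<close>

lemma pointwise_inverse:
  assumes t: "t \<in> hom FC F G" and iso: "\<And>c. c \<in> Obj C \<Longrightarrow> iso_arr T (Cmp t c)"
  shows "inverse_pair FC t (transformation G F (\<lambda>c. inv_arr T (Cmp t c)))"
    (is "inverse_pair FC t ?u")
proof -
  note F = FC_homD[OF t]
  have u: "?u \<in> hom FC G F"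
  proof (rule transformation_hom)
    fix p c d assume p: "p \<in> hom C c d" and cd: "c \<in> Obj C" "d \<in> Obj C"
    show "inv_arr T (Cmp t d) \<cdot> FArr G p = FArr F p \<cdot> inv_arr T (Cmp t c)"
      by (rule T.square_of_inverses[OF Cmp_hom[OF t cd(1)] iso[OF cd(1)]
            Cmp_hom[OF t cd(2)] iso[OF cd(2)] FArr_hom[OF F(1) p] FArr_hom[OF F(2) p]
            Cmp_natural[OF t p]])
  qed (use F T.inv_arr_hom Cmp_hom[OF t] iso in auto)
  have "Comp FC ?u t = Ident FC F"
    by (rule FC_arr_eqI[OF FC_Comp_hom[OF t u] FC_Ident_hom[OF F(1)]])
      (simp add: T.inv_arr_Comp[OF Cmp_hom[OF t] iso])
  moreover have "Comp FC t ?u = Ident FC G"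
    by (rule FC_arr_eqI[OF FC_Comp_hom[OF u t] FC_Ident_hom[OF F(2)]])
      (simp add: T.Comp_inv_arr[OF Cmp_hom[OF t] iso])
  ultimately show ?thesis
    using t u by (auto simp: inverse_pair_def hom_def)
qed

lemma
  assumes t: "t \<in> hom FC F G" and iso: "\<And>c. c \<in> Obj C \<Longrightarrow> iso_arr T (Cmp t c)"
  shows FC_iso: "iso_arr FC t"
    and Cmp_inv_arr: "c \<in> Obj C \<Longrightarrow> Cmp (inv_arr FC t) c = inv_arr T (Cmp t c)"
  using pointwise_inverse[OF assms] FC.inv_arr_eqI[OF pointwise_inverse[OF assms]]
  by (auto simp: iso_arr_def)

section \<open>The pointwise symmetric monoidal structure\<close>

lemma unit_functor_in_functors: "unit_functor C T \<in> functors C T"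
proof (rule functorsI)
  note I = T.Ident_hom[OF T.UnitObj_Obj]
  fix p c d assume "p \<in> hom C c d"
  then show "FArr (unit_functor C T) p
      \<in> hom T (FObj (unit_functor C T) c) (FObj (unit_functor C T) d)"
    using I C.hom_Dom_Obj C.hom_Cod_Obj by simp
next
  fix c assume "c \<in> Obj C"
  then show "FArr (unit_functor C T) (\<one>\<^bsub>C\<^esub> c) = \<one> (FObj (unit_functor C T) c)"
    using FArr_simps(1)[OF C.Ident_hom] by simp
next
  fix p q c d e assume p: "p \<in> hom C c d" and q: "q \<in> hom C d e"
  show "FArr (unit_functor C T) (q \<cdot>\<^bsub>C\<^esub> p)
      = FArr (unit_functor C T) q \<cdot> FArr (unit_functor C T) p"
    using FArr_simps(1)[OF C.Comp_hom[OF p q]] FArr_simps(1)[OF p] FArr_simps(1)[OF q]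
      T.Ident_Comp[OF T.Ident_hom[OF T.UnitObj_Obj]] by simp
qed (auto simp: T.UnitObj_Obj, auto simp: unit_functor_def)

lemma tensor_functor_in_functors:
  assumes F: "F \<in> functors C T" and G: "G \<in> functors C T"
  shows "tensor_functor C T F G \<in> functors C T"
proof (rule functorsI)
  fix p c d assume p: "p \<in> hom C c d"
  show "FArr (tensor_functor C T F G) p
      \<in> hom T (FObj (tensor_functor C T F G) c) (FObj (tensor_functor C T F G) d)"
    using T.TensorArr_hom[OF FArr_hom[OF F p] FArr_hom[OF G p]] FArr_simps(2)[OF p]
      C.hom_Dom_Obj[OF p] C.hom_Cod_Obj[OF p] by simp
next
  fix c assume c: "c \<in> Obj C"
  show "FArr (tensor_functor C T F G) (\<one>\<^bsub>C\<^esub> c) = \<one> (FObj (tensor_functor C T F G) c)"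
    using FArr_simps(2)[OF C.Ident_hom[OF c]] FArr_Ident[OF F c] FArr_Ident[OF G c] c
      T.TensorArr_Ident[OF FObj_Obj[OF F c] FObj_Obj[OF G c]] by simp
next
  fix p q c d e assume p: "p \<in> hom C c d" and q: "q \<in> hom C d e"
  show "FArr (tensor_functor C T F G) (q \<cdot>\<^bsub>C\<^esub> p)
      = FArr (tensor_functor C T F G) q \<cdot> FArr (tensor_functor C T F G) p"
    using FArr_simps(2)[OF C.Comp_hom[OF p q]] FArr_simps(2)[OF p] FArr_simps(2)[OF q]
      FArr_Comp[OF F p q] FArr_Comp[OF G p q]
      T.TensorArr_Comp[OF FArr_hom[OF F p] FArr_hom[OF F q] FArr_hom[OF G p] FArr_hom[OF G q]]
    by simp
qed (auto simp: T.TensorObj_Obj FObj_Obj[OF F] FObj_Obj[OF G], auto simp: tensor_functor_def)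

lemmas functor_closure = unit_functor_in_functors tensor_functor_in_functors

lemma FC_TensorArr_hom:
  assumes t: "t \<in> hom FC F F'" and u: "u \<in> hom FC G G'"
  shows "TensorArr FC t u \<in> hom FC (tensor_functor C T F G) (tensor_functor C T F' G')"
proof -
  note F = FC_homD[OF t] and G = FC_homD[OF u]
  show ?thesis
    unfolding FC_simps F G
  proof (rule transformation_hom)
    fix c assume c: "c \<in> Obj C"
    then show "Cmp t c \<otimes> Cmp u c
        \<in> hom T (FObj (tensor_functor C T F G) c) (FObj (tensor_functor C T F' G') c)"
      using T.TensorArr_hom[OF Cmp_hom[OF t c] Cmp_hom[OF u c]] by simp
  next
    fix p c d assume p: "p \<in> hom C c d" and c: "c \<in> Obj C" and d: "d \<in> Obj C"
    show "(Cmp t d \<otimes> Cmp u d) \<cdot> FArr (tensor_functor C T F G) p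
        = FArr (tensor_functor C T F' G') p \<cdot> (Cmp t c \<otimes> Cmp u c)"
      using FArr_simps(2)[OF p] Cmp_natural[OF t p] Cmp_natural[OF u p]
        T.TensorArr_Comp[OF FArr_hom[OF F(1) p] Cmp_hom[OF t d]
          FArr_hom[OF G(1) p] Cmp_hom[OF u d]]
        T.TensorArr_Comp[OF Cmp_hom[OF t c] FArr_hom[OF F(2) p]
          Cmp_hom[OF u c] FArr_hom[OF G(2) p]] by simp
  qed (use F G functor_closure in auto)
qed

lemma Cmp_TensorArr [simp]: "c \<in> Obj C \<Longrightarrow> Cmp (TensorArr FC t u) c = Cmp t c \<otimes> Cmp u c"
  by (simp add: FC_simps)

lemma FC_Assoc_hom:
  assumes F: "F \<in> functors C T" and G: "G \<in> functors C T" and H: "H \<in> functors C T"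
  shows "Assoc FC F G H \<in> hom FC (tensor_functor C T (tensor_functor C T F G) H)
    (tensor_functor C T F (tensor_functor C T G H))"
  unfolding FC_simps
proof (rule transformation_hom)
  fix p c d assume p: "p \<in> hom C c d" and c: "c \<in> Obj C" and d: "d \<in> Obj C"
  show "\<alpha> (FObj F d) (FObj G d) (FObj H d)
        \<cdot> FArr (tensor_functor C T (tensor_functor C T F G) H) p
      = FArr (tensor_functor C T F (tensor_functor C T G H)) p
        \<cdot> \<alpha> (FObj F c) (FObj G c) (FObj H c)"
    using FArr_simps(2)[OF p]
      T.Assoc_natural[OF FArr_hom[OF F p] FArr_hom[OF G p] FArr_hom[OF H p]] by simp
qed (use assms functor_closure T.Assoc_hom FObj_Obj in auto)

lemma FC_LUnit_hom:
  assumes F: "F \<in> functors C T"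
  shows "LUnit FC F \<in> hom FC (tensor_functor C T (unit_functor C T) F) F"
  unfolding FC_simps
proof (rule transformation_hom)
  fix p c d assume p: "p \<in> hom C c d"
  show "\<ell> (FObj F d) \<cdot> FArr (tensor_functor C T (unit_functor C T) F) p
      = FArr F p \<cdot> \<ell> (FObj F c)"
    using FArr_simps[OF p] T.LUnit_natural[OF FArr_hom[OF F p]] by simp
qed (use F functor_closure T.LUnit_hom FObj_Obj in auto)

lemma FC_RUnit_hom:
  assumes F: "F \<in> functors C T"
  shows "RUnit FC F \<in> hom FC (tensor_functor C T F (unit_functor C T)) F"
  unfolding FC_simps
proof (rule transformation_hom)
  fix p c d assume p: "p \<in> hom C c d"
  show "\<rho> (FObj F d) \<cdot> FArr (tensor_functor C T F (unit_functor C T)) p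
      = FArr F p \<cdot> \<rho> (FObj F c)"
    using FArr_simps[OF p] T.RUnit_natural[OF FArr_hom[OF F p]] by simp
qed (use F functor_closure T.RUnit_hom FObj_Obj in auto)

lemma FC_Braid_hom:
  assumes F: "F \<in> functors C T" and G: "G \<in> functors C T"
  shows "Braid FC F G \<in> hom FC (tensor_functor C T F G) (tensor_functor C T G F)"
  unfolding FC_simps
proof (rule transformation_hom)
  fix p c d assume p: "p \<in> hom C c d"
  show "\<sigma> (FObj F d) (FObj G d) \<cdot> FArr (tensor_functor C T F G) p
      = FArr (tensor_functor C T G F) p \<cdot> \<sigma> (FObj F c) (FObj G c)"
    using FArr_simps(2)[OF p] T.Braid_natural[OF FArr_hom[OF F p] FArr_hom[OF G p]] by simp
qed (use assms functor_closure T.Braid_hom FObj_Obj in auto)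

lemma Cmp_structure [simp]:
  assumes "c \<in> Obj C"
  shows "Cmp (Assoc FC F G H) c = \<alpha> (FObj F c) (FObj G c) (FObj H c)"
    and "Cmp (LUnit FC F) c = \<ell> (FObj F c)"
    and "Cmp (RUnit FC F) c = \<rho> (FObj F c)"
    and "Cmp (Braid FC F G) c = \<sigma> (FObj F c) (FObj G c)"
  using assms by (simp_all add: FC_simps)

lemmas FC_homs = FC_Ident_hom FC_Comp_hom FC_TensorArr_hom FC_Assoc_hom FC_LUnit_hom
  FC_RUnit_hom FC_Braid_hom functor_closure

lemma FC_Assoc_iso:
  "\<lbrakk>F \<in> functors C T; G \<in> functors C T; H \<in> functors C T\<rbrakk> \<Longrightarrow> iso_arr FC (Assoc FC F G H)"
  by (rule FC_iso[OF FC_Assoc_hom]) (auto simp: T.Assoc_iso FObj_Obj)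

lemma FC_RUnit_iso: "F \<in> functors C T \<Longrightarrow> iso_arr FC (RUnit FC F)"
  by (rule FC_iso[OF FC_RUnit_hom]) (auto simp: T.RUnit_iso FObj_Obj)

text \<open>
  Only \<open>Obj\<close>, \<open>UnitObj\<close> and \<open>TensorObj\<close> are unfolded: the operations on arrows stay folded, so
  that the typing rules \<open>FC_homs\<close> and the component rules apply to them syntactically.
\<close>

lemma FC_symmetric_monoidal: "symmetric_monoidal_category FC"
proof (unfold_locales, unfold FC_simps(1,5,6))
  show "unit_functor C T \<in> functors C T" by (rule unit_functor_in_functors)
next
  fix X Y assume XY: "X \<in> functors C T" "Y \<in> functors C T"
  show "tensor_functor C T X Y \<in> functors C T"
    by (rule tensor_functor_in_functors[OF XY])
  show "TensorArr FC (Ident FC X) (Ident FC Y) = Ident FC (tensor_functor C T X Y)"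
    by (rule FC_arr_eqI, (rule FC_homs XY)+) (simp add: T.TensorArr_Ident FObj_Obj XY)
  show "Braid FC X Y \<in> hom FC (tensor_functor C T X Y) (tensor_functor C T Y X)"
    by (rule FC_Braid_hom[OF XY])
  show "Comp FC (Braid FC Y X) (Braid FC X Y) = Ident FC (tensor_functor C T X Y)"
    by (rule FC_arr_eqI, (rule FC_homs XY)+) (simp add: T.Braid_symmetric FObj_Obj XY)
  show "Comp FC (TensorArr FC (Ident FC X) (LUnit FC Y)) (Assoc FC X (unit_functor C T) Y)
      = TensorArr FC (RUnit FC X) (Ident FC Y)"
    by (rule FC_arr_eqI, (rule FC_homs XY)+) (simp add: T.triangle FObj_Obj XY)
next
  fix f g X X' Y Y'
  assume f: "f \<in> hom FC X X'" and g: "g \<in> hom FC Y Y'"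
  show "TensorArr FC f g \<in> hom FC (tensor_functor C T X Y) (tensor_functor C T X' Y')"
    by (rule FC_TensorArr_hom[OF f g])
  show "Comp FC (Braid FC X' Y') (TensorArr FC f g) = Comp FC (TensorArr FC g f) (Braid FC X Y)"
    by (rule FC_arr_eqI, (rule FC_homs f g FC_homD[OF f] FC_homD[OF g])+)
      (simp add: T.Braid_natural[OF Cmp_hom[OF f] Cmp_hom[OF g]])
next
  fix f f' g g' X X' X'' Y Y' Y''
  assume f: "f \<in> hom FC X X'" "f' \<in> hom FC X' X''" and g: "g \<in> hom FC Y Y'" "g' \<in> hom FC Y' Y''"
  show "TensorArr FC (Comp FC f' f) (Comp FC g' g)
      = Comp FC (TensorArr FC f' g') (TensorArr FC f g)"
    by (rule FC_arr_eqI[OF FC_TensorArr_hom[OF FC_Comp_hom[OF f] FC_Comp_hom[OF g]]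
          FC_Comp_hom[OF FC_TensorArr_hom[OF f(1) g(1)] FC_TensorArr_hom[OF f(2) g(2)]]])
      (simp add: T.TensorArr_Comp[OF f[THEN Cmp_hom] g[THEN Cmp_hom]])
next
  fix X Y Z assume XYZ: "X \<in> functors C T" "Y \<in> functors C T" "Z \<in> functors C T"
  show "Assoc FC X Y Z \<in> hom FC (tensor_functor C T (tensor_functor C T X Y) Z)
      (tensor_functor C T X (tensor_functor C T Y Z))"
    by (rule FC_Assoc_hom[OF XYZ])
  show "iso_arr FC (Assoc FC X Y Z)"
    by (rule FC_Assoc_iso[OF XYZ])
  show "Comp FC (Comp FC (Assoc FC Y Z X) (Braid FC X (tensor_functor C T Y Z))) (Assoc FC X Y Z)
      = Comp FC (Comp FC (TensorArr FC (Ident FC Y) (Braid FC X Z)) (Assoc FC Y X Z))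
          (TensorArr FC (Braid FC X Y) (Ident FC Z))"
    by (rule FC_arr_eqI, (rule FC_homs XYZ)+) (simp add: T.hexagon FObj_Obj XYZ)
next
  fix f g h X X' Y Y' Z Z'
  assume f: "f \<in> hom FC X X'" and g: "g \<in> hom FC Y Y'" and h: "h \<in> hom FC Z Z'"
  show "Comp FC (Assoc FC X' Y' Z') (TensorArr FC (TensorArr FC f g) h)
      = Comp FC (TensorArr FC f (TensorArr FC g h)) (Assoc FC X Y Z)"
    by (rule FC_arr_eqI, (rule FC_homs f g h FC_homD[OF f] FC_homD[OF g] FC_homD[OF h])+)
      (simp add: T.Assoc_natural[OF Cmp_hom[OF f] Cmp_hom[OF g] Cmp_hom[OF h]])
next
  fix X assume X: "X \<in> functors C T"
  show "LUnit FC X \<in> hom FC (tensor_functor C T (unit_functor C T) X) X"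
    by (rule FC_LUnit_hom[OF X])
  show "iso_arr FC (LUnit FC X)"
    by (rule FC_iso[OF FC_LUnit_hom[OF X]]) (simp add: T.LUnit_iso FObj_Obj X)
  show "RUnit FC X \<in> hom FC (tensor_functor C T X (unit_functor C T)) X"
    by (rule FC_RUnit_hom[OF X])
  show "iso_arr FC (RUnit FC X)"
    by (rule FC_RUnit_iso[OF X])
next
  fix f X Y assume f: "f \<in> hom FC X Y"
  show "Comp FC (LUnit FC Y) (TensorArr FC (Ident FC (unit_functor C T)) f)
      = Comp FC f (LUnit FC X)"
    by (rule FC_arr_eqI, (rule FC_homs f FC_homD[OF f])+)
      (simp add: T.LUnit_natural[OF Cmp_hom[OF f]])
  show "Comp FC (RUnit FC Y) (TensorArr FC f (Ident FC (unit_functor C T)))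
      = Comp FC f (RUnit FC X)"
    by (rule FC_arr_eqI, (rule FC_homs f FC_homD[OF f])+)
      (simp add: T.RUnit_natural[OF Cmp_hom[OF f]])
next
  fix W X Y Z
  assume WXYZ: "W \<in> functors C T" "X \<in> functors C T" "Y \<in> functors C T" "Z \<in> functors C T"
  show "Comp FC (Assoc FC W X (tensor_functor C T Y Z)) (Assoc FC (tensor_functor C T W X) Y Z)
      = Comp FC (Comp FC (TensorArr FC (Ident FC W) (Assoc FC X Y Z))
          (Assoc FC W (tensor_functor C T X Y) Z)) (TensorArr FC (Assoc FC W X Y) (Ident FC Z))"
    by (rule FC_arr_eqI, (rule FC_homs WXYZ)+) (simp add: T.pentagon FObj_Obj WXYZ)
qed

end

section \<open>The pointwise trace\<close>

locale functors_into_uniform = C: category C + T: uniform_traced_category T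
  for C :: "('c, 'd, 'x) cat_data_scheme"
    and T :: "('o, 'm, 'y) traced_data_scheme" (structure)
begin

sublocale functors_into_smc C T ..

sublocale FC: symmetric_monoidal_category FC
  by (rule FC_symmetric_monoidal)

lemma Cmp_tensor_hom:
  assumes "k \<in> hom FC (tensor_functor C T F P) (tensor_functor C T G Q)" and "c \<in> Obj C"
  shows "Cmp k c \<in> hom T (FObj F c \<odot> FObj P c) (FObj G c \<odot> FObj Q c)"
  using Cmp_hom[OF assms] assms(2) by simp

lemma FC_Trace_hom:
  assumes F: "F \<in> functors C T" and G: "G \<in> functors C T" and P: "P \<in> functors C T"
    and k: "k \<in> hom FC (tensor_functor C T F P) (tensor_functor C T G P)"
  shows "Trace FC P F G k \<in> hom FC F G"
  unfolding FC_simps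
proof (rule transformation_hom)
  fix c assume c: "c \<in> Obj C"
  show "Tr (FObj P c) (FObj F c) (FObj G c) (Cmp k c) \<in> hom T (FObj F c) (FObj G c)"
    using T.Trace_hom Cmp_tensor_hom[OF k c] FObj_Obj[OF _ c] F G P by simp
next
  fix p c d assume p: "p \<in> hom C c d" and c: "c \<in> Obj C" and d: "d \<in> Obj C"
  have "Cmp k d \<cdot> (FArr F p \<otimes> FArr P p) = (FArr G p \<otimes> FArr P p) \<cdot> Cmp k c"
    using Cmp_natural[OF k p] FArr_simps(2)[OF p] by simp
  then show "Tr (FObj P d) (FObj F d) (FObj G d) (Cmp k d) \<cdot> FArr F p
      = FArr G p \<cdot> Tr (FObj P c) (FObj F c) (FObj G c) (Cmp k c)"
    by (rule T.trace_commutes_with_squares[OF Cmp_tensor_hom[OF k c] Cmp_tensor_hom[OF k d]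
          FArr_hom[OF F p] FArr_hom[OF G p] FArr_hom[OF P p]])
qed (fact F G)+

lemma Cmp_Trace [simp]:
  "c \<in> Obj C \<Longrightarrow> Cmp (Trace FC P F G k) c = Tr (FObj P c) (FObj F c) (FObj G c) (Cmp k c)"
  by (simp add: FC_simps)

lemma FC_inv_Assoc_hom:
  "\<lbrakk>F \<in> functors C T; G \<in> functors C T; H \<in> functors C T\<rbrakk>
    \<Longrightarrow> inv_arr FC (Assoc FC F G H) \<in> hom FC (tensor_functor C T F (tensor_functor C T G H))
      (tensor_functor C T (tensor_functor C T F G) H)"
  by (rule FC.inv_arr_hom[OF FC_Assoc_hom FC_Assoc_iso])

lemma FC_inv_RUnit_hom:
  "F \<in> functors C T
    \<Longrightarrow> inv_arr FC (RUnit FC F) \<in> hom FC F (tensor_functor C T F (unit_functor C T))"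
  by (rule FC.inv_arr_hom[OF FC_RUnit_hom FC_RUnit_iso])

lemma Cmp_inv_Assoc:
  assumes "F \<in> functors C T" "G \<in> functors C T" "H \<in> functors C T" "c \<in> Obj C"
  shows "Cmp (inv_arr FC (Assoc FC F G H)) c
    = inv_arr T (\<alpha> (FObj F c) (FObj G c) (FObj H c))"
  using Cmp_inv_arr[OF FC_Assoc_hom[OF assms(1-3)]] assms by (simp add: T.Assoc_iso FObj_Obj)

lemma Cmp_inv_RUnit:
  assumes "F \<in> functors C T" "c \<in> Obj C"
  shows "Cmp (inv_arr FC (RUnit FC F)) c = inv_arr T (\<rho> (FObj F c))"
  using Cmp_inv_arr[OF FC_RUnit_hom[OF assms(1)]] assms by (simp add: T.RUnit_iso FObj_Obj)

lemmas FC_traced_homs = FC_homs FC_Trace_hom FC_inv_Assoc_hom FC_inv_RUnit_hom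

lemma FC_traced: "traced_category FC"
proof (unfold_locales, unfold FC_simps(1,5,6))
  fix A B U k
  assume AB: "A \<in> functors C T" "B \<in> functors C T" and U: "U \<in> functors C T"
    and k: "k \<in> hom FC (tensor_functor C T A U) (tensor_functor C T B U)"
  show "Trace FC U A B k \<in> hom FC A B"
    by (rule FC_Trace_hom[OF AB U k])
  fix h A' B' assume h: "h \<in> hom FC A' B'"
  note objs = AB U FC_homD(1,2)[OF h]
  show "Trace FC U (tensor_functor C T A' A) (tensor_functor C T B' B)
      (Comp FC (Comp FC (inv_arr FC (Assoc FC B' B U)) (TensorArr FC h k)) (Assoc FC A' A U))
    = TensorArr FC h (Trace FC U A B k)"
    by (rule FC_arr_eqI, (rule FC_traced_homs h k objs)+)
      (simp add: Cmp_inv_Assoc objs FObj_Obj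
        T.superposing[OF _ _ _ Cmp_hom[OF h] Cmp_tensor_hom[OF k]])
next
  fix A A' B B' U f g k
  assume U: "U \<in> functors C T" and f: "f \<in> hom FC A' A" and g: "g \<in> hom FC B B'"
    and k: "k \<in> hom FC (tensor_functor C T A U) (tensor_functor C T B U)"
  note objs = U FC_homD(1,2)[OF f] FC_homD(1,2)[OF g]
  show "Trace FC U A' B' (Comp FC (Comp FC (TensorArr FC g (Ident FC U)) k)
        (TensorArr FC f (Ident FC U)))
      = Comp FC (Comp FC g (Trace FC U A B k)) f"
    by (rule FC_arr_eqI, (rule FC_traced_homs f g k objs)+)
      (simp add: objs FObj_Obj
        T.naturality[OF _ Cmp_hom[OF f] Cmp_hom[OF g] Cmp_tensor_hom[OF k]])
next
  fix A B U V h k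
  assume AB: "A \<in> functors C T" "B \<in> functors C T" and h: "h \<in> hom FC U V"
    and k: "k \<in> hom FC (tensor_functor C T A V) (tensor_functor C T B U)"
  note objs = AB FC_homD(1,2)[OF h]
  show "Trace FC V A B (Comp FC (TensorArr FC (Ident FC B) h) k)
      = Trace FC U A B (Comp FC k (TensorArr FC (Ident FC A) h))"
    by (rule FC_arr_eqI, (rule FC_traced_homs h k objs)+)
      (simp add: objs FObj_Obj T.dinaturality[OF _ _ Cmp_hom[OF h] Cmp_tensor_hom[OF k]])
next
  fix A B k
  assume objs: "A \<in> functors C T" "B \<in> functors C T"
    and k: "k \<in> hom FC (tensor_functor C T A (unit_functor C T))
      (tensor_functor C T B (unit_functor C T))"
  have k_hom: "Cmp k c \<in> hom T (FObj A c \<odot> \<I>) (FObj B c \<odot> \<I>)" if "c \<in> Obj C" for c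
    using Cmp_tensor_hom[OF k that] that by simp
  show "Trace FC (unit_functor C T) A B k
      = Comp FC (Comp FC (RUnit FC B) k) (inv_arr FC (RUnit FC A))"
    by (rule FC_arr_eqI, (rule FC_traced_homs k objs)+)
      (simp add: Cmp_inv_RUnit objs FObj_Obj T.monoidality_unit[OF _ _ k_hom])
next
  fix A B U V k
  assume objs: "A \<in> functors C T" "B \<in> functors C T" "U \<in> functors C T" "V \<in> functors C T"
    and k: "k \<in> hom FC (tensor_functor C T A (tensor_functor C T U V))
      (tensor_functor C T B (tensor_functor C T U V))"
  have k_hom: "Cmp k c \<in> hom T (FObj A c \<odot> (FObj U c \<odot> FObj V c)) (FObj B c \<odot> (FObj U c \<odot> FObj V c))"
    if "c \<in> Obj C" for c
    using Cmp_tensor_hom[OF k that] that by simp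
  show "Trace FC (tensor_functor C T U V) A B k
      = Trace FC U A B (Trace FC V (tensor_functor C T A U) (tensor_functor C T B U)
          (Comp FC (Comp FC (inv_arr FC (Assoc FC B U V)) k) (Assoc FC A U V)))"
    by (rule FC_arr_eqI, (rule FC_traced_homs k objs)+)
      (simp add: Cmp_inv_Assoc objs FObj_Obj T.monoidality_tensor[OF _ _ _ _ k_hom])
next
  fix U assume U: "U \<in> functors C T"
  show "Trace FC U U U (Braid FC U U) = Ident FC U"
    by (rule FC_arr_eqI, (rule FC_traced_homs U)+) (simp add: T.yanking FObj_Obj U)
qed

lemma FC_strict:
  assumes s: "s \<in> hom FC U V"
  shows "strict_arr FC s"
proof -
  note UV = FC_homD[OF s]
  have "Trace FC U A B f = Trace FC V A B g"
    if A: "A \<in> functors C T" and B: "B \<in> functors C T"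
      and f: "f \<in> hom FC (tensor_functor C T A U) (tensor_functor C T B U)"
      and g: "g \<in> hom FC (tensor_functor C T A V) (tensor_functor C T B V)"
      and intertwine: "Comp FC (TensorArr FC (Ident FC B) s) f
        = Comp FC g (TensorArr FC (Ident FC A) s)"
    for A B f g
  proof (rule FC_arr_eqI[OF FC_Trace_hom[OF A B UV(1) f] FC_Trace_hom[OF A B UV(2) g]])
    fix c assume c: "c \<in> Obj C"
    note sc = Cmp_hom[OF s c]
    have "Cmp (Comp FC (TensorArr FC (Ident FC B) s) f) c
        = Cmp (Comp FC g (TensorArr FC (Ident FC A) s)) c"
      using intertwine by simp
    then have "(\<one> (FObj B c) \<otimes> Cmp s c) \<cdot> Cmp f c = Cmp g c \<cdot> (\<one> (FObj A c) \<otimes> Cmp s c)"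
      using c by simp
    moreover have "strict_arr T (Cmp s c)"
      "Dom T (Cmp s c) = FObj U c" "Cod T (Cmp s c) = FObj V c"
      using T.uniform sc by (auto simp: hom_def)
    ultimately show "Cmp (Trace FC U A B f) c = Cmp (Trace FC V A B g) c"
      using c Cmp_tensor_hom[OF f c] Cmp_tensor_hom[OF g c] FObj_Obj[OF A c] FObj_Obj[OF B c]
      by (auto simp: strict_arr_def Let_def)
  qed
  moreover have "s \<in> Arr FC"
    using s by (simp add: hom_def)
  ultimately show ?thesis
    unfolding strict_arr_def Let_def FC_simps(1-3,6) UV by blast
qed

lemma FC_uniform_traced: "uniform_traced_category FC"
proof -
  interpret FC: traced_category FC by (rule FC_traced)
  show ?thesis
    by unfold_locales (auto intro: FC_strict simp: hom_def)
qed

end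

theorem proposition2p17:
  fixes T :: "('o, 'm) traced_data" and C :: "('c, 'd) cat_data"
  assumes "uniform_traced_category T"
    and "category C"
  shows "uniform_traced_category (functor_category C T)"
proof -
  interpret functors_into_uniform C T
    using assms by (simp add: functors_into_uniform_def)
  show ?thesis by (rule FC_uniform_traced)
qed

end
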